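(* Let $\mathcal S$ be a subsemigroup of $\mathbb S$ and $\mathcal E\subseteq\mathbb S$. For a space $Y$, let $$\mathfrak T(\mathcal E,\mathcal S)_Y=\left\{s\in Y^{\mathbb N}:\exists\phi\in\mathcal E\ \left(s\circ\phi\in\mathrm{SDS}_Y^{\mathcal S}\right)\right\}.$$ Then, for any space $X$ and $\mathbf H(X)\in\{\mathcal P_{\mathrm{fin}}(X),\mathcal F[X]\}$, $$\vec{\mathsf G}_1(\mathcal T_X,\mathfrak T(\mathcal E,\mathcal S)_X)\leq^+_{\mathrm{II}}\vec{\mathsf G}_1(\mathcal T_{\mathbf H(X)},\mathfrak T(\mathcal E,\mathcal S)_{\mathbf H(X)}).$$ Consequently, for any $\mathfrak B\in\{\mathrm{SDS},\mathrm{wSD},\mathrm{gSDS}\}\cup\{\mathrm{wSD}^\alpha:\alpha\in(0,1]\}$, $$\vec{\mathsf G}_1(\mathcal T_X,\mathfrak B_X)\leq^+_{\mathrm{II}}\vec{\mathsf G}_1(\mathcal T_{\mathbf H(X)},\mathfrak B_{\mathbf H(X)}).$$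
   Context: $\mathbb N$ is the set of positive integers. A space is a nonempty topological space; no separation axioms are assumed. $\mathcal T_X$ is the set of nonempty open subsets of $X$; $\mathcal N_{X,x}$ is the set of open sets containing $x$. $\mathbb S$ is the semigroup (under composition) of strictly increasing functions $\mathbb N\to\mathbb N$, topologized as a subspace of the product $\mathbb N^{\mathbb N}$ of discrete spaces. For a subsemigroup $\mathcal S$ of $\mathbb S$ and a space $X$, $\mathrm{SDS}^{\mathcal S}_X$ is the set of $s\in X^{\mathbb N}$ such that for all $\phi\in\mathcal S$ and all $x\in X$ there are $U\in\mathcal N_{X,x}$ and $\psi\in\mathcal S$ with $s(\phi(\psi(n)))\notin U$ for all $n\in\mathbb N$. $\mathrm{CS}_X$ is the set of sequences in $X^{\mathbb N}$ converging to some point of $X$. $\mathrm{SDS}_X=\{s\in X^{\mathbb N}:\forall\phi\in\mathbb S\ (s\circ\phi\notin\mathrm{CS}_X)\}$. $\mathrm{wSD}_X=\{s\in X^{\mathbb N}:\exists\phi\in\mathbb S\ (s\circ\phi\in\mathrm{SDS}_X)\}$. $\mathrm{gSDS}_X$ is the set of $s\in X^{\mathbb N}$ such that $\{\phi\in\mathbb S:s\circ\phi\in\mathrm{SDS}_X\}$ is comeager in $\mathbb S$. For $\alpha\in(0,1]$, $\mathrm{wSD}^\alpha_X=\{s\in X^{\mathbb N}:\exists\phi\in\mathbf D^\ast_\alpha\ (s\circ\phi\in\mathrm{SDS}_X)\}$, where $\mathbf D_\alpha^\ast$ is the set of $\phi\in\mathbb S$ with $\lim_{n\to\infty}\frac{\#(C_\phi\cap[1,n])}{n^\alpha}=0$,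 $C_\phi=\mathbb N\setminus\{\phi(k):k\in\mathbb N\}$. Hyperspaces. On the set $[X]^{<\aleph_0}$ of nonempty finite subsets of $X$: $\mathcal P_{\mathrm{fin}}(X)$ carries the Vietoris topology, with basis the sets $[U_1,\ldots,U_n]=\{F:F\subseteq\bigcup_{j}U_j,\ F\cap U_j\neq\varnothing\text{ for all }1\le j\le n\}$, $n\in\mathbb N$, $U_j\in\mathcal T_X$; $\mathcal F[X]$ carries the Pixley-Roy topology, with basis the sets $[F,U]=\{G:F\subseteq G\subseteq U\}$, $F\in[X]^{<\aleph_0}$, $U\in\mathcal T_X$. Games. For a collection $\mathcal A$ of sets and a set $\mathcal B$ of sequences, in round $n\in\mathbb N$ of the game $\vec{\mathsf G}_1(\mathcal A,\mathcal B)$, P1 chooses $A_n\in\mathcal A$ and P2 responds with $x_n\in A_n$. P2 wins if the sequence $\langle x_n:n\in\mathbb N\rangle$ is in $\mathcal B$; otherwise P1 wins. Strategies. A strategy for P1 assigns to each finite sequence (possibly empty) of previous P2 moves an element of $\mathcal A$; a predetermined strategy for P1 is a function $\sigma:\mathbb N\to\mathcal A$ (depending only on the round number); a constant strategy for P1 always plays one fixed $A_0\in\mathcal A$. A strategy for P2 assigns to each finite sequence $\langle A_1,\dots,A_n\rangle$ of P1 moves a legal response to $A_n$; a Markov strategy for P2 assigns to each pair $(A,n)\in\mathcal A\times\mathbb N$ a legal response to $A$. A strategy is winning if its player wins every run in which they follow it. Write $\mathrm I\uparrow\mathcal G$, $\mathrm I\uparrow_{\mathrm{pre}}\mathcal G$,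 $\mathrm I\uparrow_{\mathrm{cnst}}\mathcal G$ if P1 has a winning strategy, a winning predetermined strategy, a winning constant strategy, respectively, in $\mathcal G$; and $\mathrm{II}\uparrow\mathcal G$, $\mathrm{II}\uparrow_{\mathrm{mark}}\mathcal G$ if P2 has a winning strategy, a winning Markov strategy, respectively. A slashed arrow denotes negation. $\mathcal G\leq^+_{\mathrm{II}}\mathcal H$ means that all of the following hold: $\mathrm{II}\uparrow_{\mathrm{mark}}\mathcal G\Rightarrow\mathrm{II}\uparrow_{\mathrm{mark}}\mathcal H$; $\mathrm{II}\uparrow\mathcal G\Rightarrow\mathrm{II}\uparrow\mathcal H$; $\mathrm I\not\uparrow\mathcal G\Rightarrow\mathrm I\not\uparrow\mathcal H$; $\mathrm I\not\uparrow_{\mathrm{pre}}\mathcal G\Rightarrow\mathrm I\not\uparrow_{\mathrm{pre}}\mathcal H$; $\mathrm I\not\uparrow_{\mathrm{cnst}}\mathcal G\Rightarrow\mathrm I\not\uparrow_{\mathrm{cnst}}\mathcal H$. *)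

theory Defs
  imports "HOL-Analysis.Analysis"
begin

text \<open>
  The positive integers are represented by the type \<open>nat\<close>, the number \<open>n + 1\<close> being
  identified with \<open>n\<close>. Sequences, rounds of a game, and strictly increasing maps are
  re-indexed accordingly; in particular the initial segment \<open>[1, n]\<close> becomes \<open>{..<n}\<close>.
  A space is a topology \<open>X :: 'a topology\<close> with \<open>topspace X \<noteq> {}\<close>.
\<close>

section \<open>Sequences and strictly increasing maps\<close>

definition nonempty_opens :: "'a topology \<Rightarrow> 'a set set" where
  "nonempty_opens X = {U. openin X U \<and> U \<noteq> {}}"

definition seqs :: "'a topology \<Rightarrow> (nat \<Rightarrow> 'a) set" where
  "seqs X = {s. range s \<subseteq> topspace X}"

definition incr :: "(nat \<Rightarrow> nat) set" where
  "incr = {\<phi>. strict_mono \<phi>}"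

definition incr_topology :: "(nat \<Rightarrow> nat) topology" where
  "incr_topology =
     subtopology (product_topology (\<lambda>_. discrete_topology UNIV) UNIV) incr"

definition subsemigroup :: "(nat \<Rightarrow> nat) set \<Rightarrow> bool" where
  "subsemigroup S \<longleftrightarrow> S \<subseteq> incr \<and> (\<forall>\<phi>\<in>S. \<forall>\<psi>\<in>S. \<phi> \<circ> \<psi> \<in> S)"

definition nowhere_dense_in :: "'a topology \<Rightarrow> 'a set \<Rightarrow> bool" where
  "nowhere_dense_in X A \<longleftrightarrow>
     A \<subseteq> topspace X \<and> X interior_of (X closure_of A) = {}"

definition meager_in :: "'a topology \<Rightarrow> 'a set \<Rightarrow> bool" where
  "meager_in X A \<longleftrightarrow>
     (\<exists>\<N>. countable \<N> \<and> (\<forall>N\<in>\<N>. nowhere_dense_in X N) \<and> A = \<Union>\<N>)"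

definition comeager_in :: "'a topology \<Rightarrow> 'a set \<Rightarrow> bool" where
  "comeager_in X A \<longleftrightarrow> A \<subseteq> topspace X \<and> meager_in X (topspace X - A)"

definition SDS_semi :: "(nat \<Rightarrow> nat) set \<Rightarrow> 'a topology \<Rightarrow> (nat \<Rightarrow> 'a) set" where
  "SDS_semi S X =
     {s \<in> seqs X. \<forall>\<phi>\<in>S. \<forall>x\<in>topspace X.
        \<exists>U. openin X U \<and> x \<in> U \<and> (\<exists>\<psi>\<in>S. \<forall>n. s (\<phi> (\<psi> n)) \<notin> U)}"

definition TT :: "(nat \<Rightarrow> nat) set \<Rightarrow> (nat \<Rightarrow> nat) set \<Rightarrow> 'a topology \<Rightarrow> (nat \<Rightarrow> 'a) set" where
  "TT E S Y = {s \<in> seqs Y. \<exists>\<phi>\<in>E. s \<circ> \<phi> \<in> SDS_semi S Y}"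

definition CS :: "'a topology \<Rightarrow> (nat \<Rightarrow> 'a) set" where
  "CS X = {s \<in> seqs X. \<exists>x\<in>topspace X. limitin X s x sequentially}"

definition SDS :: "'a topology \<Rightarrow> (nat \<Rightarrow> 'a) set" where
  "SDS X = {s \<in> seqs X. \<forall>\<phi>\<in>incr. s \<circ> \<phi> \<notin> CS X}"

definition wSD :: "'a topology \<Rightarrow> (nat \<Rightarrow> 'a) set" where
  "wSD X = {s \<in> seqs X. \<exists>\<phi>\<in>incr. s \<circ> \<phi> \<in> SDS X}"

definition gSDS :: "'a topology \<Rightarrow> (nat \<Rightarrow> 'a) set" where
  "gSDS X = {s \<in> seqs X. comeager_in incr_topology {\<phi> \<in> incr. s \<circ> \<phi> \<in> SDS X}}"

definition Dstar :: "real \<Rightarrow> (nat \<Rightarrow> nat) set" where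
  "Dstar \<alpha> =
     {\<phi> \<in> incr. (\<lambda>n. real (card ((UNIV - range \<phi>) \<inter> {..<n})) / real n powr \<alpha>) \<longlonglongrightarrow> 0}"

definition wSD_alpha :: "real \<Rightarrow> 'a topology \<Rightarrow> (nat \<Rightarrow> 'a) set" where
  "wSD_alpha \<alpha> X = {s \<in> seqs X. \<exists>\<phi>\<in>Dstar \<alpha>. s \<circ> \<phi> \<in> SDS X}"

section \<open>Hyperspaces\<close>

definition finite_subsets :: "'a topology \<Rightarrow> 'a set set" where
  "finite_subsets X = {F. F \<subseteq> topspace X \<and> finite F \<and> F \<noteq> {}}"

text \<open>The basic Vietoris set \<open>[U\<^sub>1, \<dots>, U\<^sub>n]\<close> depends only on the set \<open>\<U> = {U\<^sub>1, \<dots>, U\<^sub>n}\<close>.\<close>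

definition vietoris_set :: "'a topology \<Rightarrow> 'a set set \<Rightarrow> 'a set set" where
  "vietoris_set X \<U> = {F \<in> finite_subsets X. F \<subseteq> \<Union>\<U> \<and> (\<forall>U\<in>\<U>. F \<inter> U \<noteq> {})}"

definition vietoris_basis :: "'a topology \<Rightarrow> 'a set set set" where
  "vietoris_basis X =
     {vietoris_set X \<U> |\<U>. finite \<U> \<and> \<U> \<noteq> {} \<and> \<U> \<subseteq> nonempty_opens X}"

definition vietoris :: "'a topology \<Rightarrow> 'a set topology" where
  "vietoris X = topology (arbitrary union_of (\<lambda>W. W \<in> vietoris_basis X))"

definition pixley_roy_set :: "'a topology \<Rightarrow> 'a set \<Rightarrow> 'a set \<Rightarrow> 'a set set" where
  "pixley_roy_set X F U = {G \<in> finite_subsets X. F \<subseteq> G \<and> G \<subseteq> U}"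

definition pixley_roy_basis :: "'a topology \<Rightarrow> 'a set set set" where
  "pixley_roy_basis X =
     {pixley_roy_set X F U |F U. F \<in> finite_subsets X \<and> U \<in> nonempty_opens X}"

definition pixley_roy :: "'a topology \<Rightarrow> 'a set topology" where
  "pixley_roy X = topology (arbitrary union_of (\<lambda>W. W \<in> pixley_roy_basis X))"

text \<open>The two families are bases, so the open sets are exactly the unions of basic sets.\<close>

lemma vietoris_set_Int:
  assumes "W1 \<in> vietoris_basis X" "W2 \<in> vietoris_basis X"
  shows "W1 \<inter> W2 = {} \<or> W1 \<inter> W2 \<in> vietoris_basis X"
proof -
  obtain \<U> \<V> where U: "finite \<U>" "\<U> \<noteq> {}" "\<U> \<subseteq> nonempty_opens X" "W1 = vietoris_set X \<U>"
    and V: "finite \<V>" "\<V> \<noteq> {}" "\<V> \<subseteq> nonempty_opens X" "W2 = vietoris_set X \<V>"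
    using assms unfolding vietoris_basis_def by blast
  define \<W> where "\<W> = (\<lambda>U. U \<inter> \<Union>\<V>) ` \<U> \<union> (\<lambda>V. V \<inter> \<Union>\<U>) ` \<V>"
  have eq: "W1 \<inter> W2 = vietoris_set X \<W>"
  proof (intro equalityI subsetI)
    fix F assume "F \<in> W1 \<inter> W2"
    then have F: "F \<in> finite_subsets X" "F \<subseteq> \<Union>\<U>" "F \<subseteq> \<Union>\<V>"
      "\<And>U. U \<in> \<U> \<Longrightarrow> F \<inter> U \<noteq> {}" "\<And>V. V \<in> \<V> \<Longrightarrow> F \<inter> V \<noteq> {}"
      unfolding U(4) V(4) vietoris_set_def by auto
    have "F \<subseteq> \<Union>\<W>"
    proof
      fix x assume x: "x \<in> F"
      then obtain U where "U \<in> \<U>" "x \<in> U" "x \<in> \<Union>\<V>"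
        using F(2,3) by blast
      then have "U \<inter> \<Union>\<V> \<in> \<W>" "x \<in> U \<inter> \<Union>\<V>"
        unfolding \<W>_def by auto
      then show "x \<in> \<Union>\<W>" by (rule UnionI)
    qed
    moreover have "F \<inter> W \<noteq> {}" if W: "W \<in> \<W>" for W
    proof -
      consider U where "U \<in> \<U>" "W = U \<inter> \<Union>\<V>" | V where "V \<in> \<V>" "W = V \<inter> \<Union>\<U>"
        using W unfolding \<W>_def by auto
      then show ?thesis
      proof cases
        case 1
        then have "F \<inter> W = F \<inter> U" using F(3) by auto
        then show ?thesis using F(4) 1(1) by simp
      next
        case 2
        then have "F \<inter> W = F \<inter> V" using F(2) by auto
        then show ?thesis using F(5) 2(1) by simp
      qed
    qed
    ultimately show "F \<in> vietoris_set X \<W>"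
      using F(1) by (simp add: vietoris_set_def)
  next
    fix F assume "F \<in> vietoris_set X \<W>"
    then have F: "F \<in> finite_subsets X" "F \<subseteq> \<Union>\<W>" "\<And>W. W \<in> \<W> \<Longrightarrow> F \<inter> W \<noteq> {}"
      unfolding vietoris_set_def by auto
    have "\<Union>\<W> \<subseteq> \<Union>\<U>" "\<Union>\<W> \<subseteq> \<Union>\<V>"
      unfolding \<W>_def by auto
    then have "F \<subseteq> \<Union>\<U>" "F \<subseteq> \<Union>\<V>"
      using subset_trans[OF F(2)] by simp_all
    moreover have "F \<inter> U \<noteq> {}" if "U \<in> \<U>" for U
    proof -
      have "U \<inter> \<Union>\<V> \<in> \<W>" using that unfolding \<W>_def by simp
      from F(3)[OF this] show ?thesis by auto
    qed
    moreover have "F \<inter> V \<noteq> {}" if "V \<in> \<V>" for V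
    proof -
      have "V \<inter> \<Union>\<U> \<in> \<W>" using that unfolding \<W>_def by simp
      from F(3)[OF this] show ?thesis by auto
    qed
    ultimately show "F \<in> W1 \<inter> W2"
      using F(1) by (simp add: U(4) V(4) vietoris_set_def)
  qed
  show ?thesis
  proof (cases "{} \<in> \<W>")
    case True
    then have "vietoris_set X \<W> = {}"
      unfolding vietoris_set_def by blast
    then show ?thesis using eq by simp
  next
    case False
    have "openin X W" if "W \<in> \<W>" for W
    proof -
      have "openin X (\<Union>\<U>)" "openin X (\<Union>\<V>)"
        using U(3) V(3) by (auto simp: nonempty_opens_def intro!: openin_Union)
      then show ?thesis
        using that U(3) V(3) unfolding \<W>_def nonempty_opens_def by auto
    qed
    then have "\<W> \<subseteq> nonempty_opens X"
      using False by (auto simp: nonempty_opens_def)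
    moreover have "finite \<W>" "\<W> \<noteq> {}"
      using U V by (auto simp: \<W>_def)
    ultimately show ?thesis
      using eq unfolding vietoris_basis_def by blast
  qed
qed

lemma pixley_roy_set_Int:
  assumes "W1 \<in> pixley_roy_basis X" "W2 \<in> pixley_roy_basis X"
  shows "W1 \<inter> W2 = {} \<or> W1 \<inter> W2 \<in> pixley_roy_basis X"
proof -
  obtain F U G V where F: "F \<in> finite_subsets X" "U \<in> nonempty_opens X" "W1 = pixley_roy_set X F U"
    and G: "G \<in> finite_subsets X" "V \<in> nonempty_opens X" "W2 = pixley_roy_set X G V"
    using assms unfolding pixley_roy_basis_def by blast
  have eq: "W1 \<inter> W2 = pixley_roy_set X (F \<union> G) (U \<inter> V)"
    unfolding F(3) G(3) pixley_roy_set_def by blast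
  show ?thesis
  proof (cases "U \<inter> V = {}")
    case True
    then show ?thesis
      unfolding eq pixley_roy_set_def finite_subsets_def by auto
  next
    case False
    then have "U \<inter> V \<in> nonempty_opens X" "F \<union> G \<in> finite_subsets X"
      using F G by (auto simp: nonempty_opens_def finite_subsets_def)
    then show ?thesis
      unfolding eq pixley_roy_basis_def by blast
  qed
qed

lemma openin_topology_of_base:
  assumes "\<And>V W. V \<in> \<B> \<Longrightarrow> W \<in> \<B> \<Longrightarrow> V \<inter> W = {} \<or> V \<inter> W \<in> \<B>"
  shows "openin (topology (arbitrary union_of (\<lambda>W. W \<in> \<B>))) A \<longleftrightarrow> (\<exists>\<C>\<subseteq>\<B>. A = \<Union>\<C>)"
proof -
  have "istopology (arbitrary union_of (\<lambda>W. W \<in> \<B>))"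
    unfolding istopology_base_eq
    using assms by (metis arbitrary_union_of_empty arbitrary_union_of_inc)
  then show ?thesis
    by (auto simp: topology_inverse' union_of_def arbitrary_def)
qed

lemma openin_vietoris: "openin (vietoris X) A \<longleftrightarrow> (\<exists>\<C>\<subseteq>vietoris_basis X. A = \<Union>\<C>)"
  unfolding vietoris_def by (rule openin_topology_of_base) (rule vietoris_set_Int)

lemma openin_pixley_roy: "openin (pixley_roy X) A \<longleftrightarrow> (\<exists>\<C>\<subseteq>pixley_roy_basis X. A = \<Union>\<C>)"
  unfolding pixley_roy_def by (rule openin_topology_of_base) (rule pixley_roy_set_Int)

lemma topspace_vietoris: "topspace (vietoris X) = finite_subsets X"
proof
  show "topspace (vietoris X) \<subseteq> finite_subsets X"
    using openin_topspace[of "vietoris X"]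
    unfolding openin_vietoris vietoris_basis_def vietoris_set_def by blast
  have "F \<in> topspace (vietoris X)" if F: "F \<in> finite_subsets X" for F
  proof -
    have "{topspace X} \<subseteq> nonempty_opens X"
      using F by (auto simp: nonempty_opens_def finite_subsets_def)
    then have "vietoris_set X {topspace X} \<in> vietoris_basis X"
      unfolding vietoris_basis_def by (intro CollectI exI[of _ "{topspace X}"]) simp
    then have "openin (vietoris X) (vietoris_set X {topspace X})"
      unfolding openin_vietoris by (intro exI[of _ "{vietoris_set X {topspace X}}"]) auto
    moreover have "F \<in> vietoris_set X {topspace X}"
      using F by (auto simp: vietoris_set_def finite_subsets_def)
    ultimately show ?thesis using openin_subset by blast
  qed
  then show "finite_subsets X \<subseteq> topspace (vietoris X)" by blast
qed

lemma topspace_pixley_roy: "topspace (pixley_roy X) = finite_subsets X"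
proof
  show "topspace (pixley_roy X) \<subseteq> finite_subsets X"
    using openin_topspace[of "pixley_roy X"]
    unfolding openin_pixley_roy pixley_roy_basis_def pixley_roy_set_def by blast
  have "F \<in> topspace (pixley_roy X)" if F: "F \<in> finite_subsets X" for F
  proof -
    have "topspace X \<in> nonempty_opens X"
      using F by (auto simp: nonempty_opens_def finite_subsets_def)
    then have "pixley_roy_set X F (topspace X) \<in> pixley_roy_basis X"
      using F unfolding pixley_roy_basis_def by blast
    then have "openin (pixley_roy X) (pixley_roy_set X F (topspace X))"
      unfolding openin_pixley_roy
      by (intro exI[of _ "{pixley_roy_set X F (topspace X)}"]) auto
    moreover have "F \<in> pixley_roy_set X F (topspace X)"
      using F by (auto simp: pixley_roy_set_def finite_subsets_def)
    ultimately show ?thesis using openin_subset by blast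
  qed
  then show "finite_subsets X \<subseteq> topspace (pixley_roy X)" by blast
qed

section \<open>Games and strategies\<close>

text \<open>
  \<open>G1 \<A> \<B>\<close> is the game in which P1 plays \<open>A\<^sub>n \<in> \<A>\<close>, P2 answers with \<open>x\<^sub>n \<in> A\<^sub>n\<close>, and P2 wins
  iff the sequence of the \<open>x\<^sub>n\<close> belongs to \<open>\<B>\<close>.
\<close>

datatype 'a game = G1 (moves: "'a set set") (target: "(nat \<Rightarrow> 'a) set")

definition I_wins :: "'a game \<Rightarrow> bool" where
  "I_wins G \<longleftrightarrow>
     (\<exists>\<sigma> :: 'a list \<Rightarrow> 'a set.
        (\<forall>xs\<in>lists (\<Union>(moves G)). \<sigma> xs \<in> moves G) \<and>
        (\<forall>x. (\<forall>n. x n \<in> \<sigma> (map x [0..<n])) \<longrightarrow> x \<notin> target G))"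

definition I_wins_pre :: "'a game \<Rightarrow> bool" where
  "I_wins_pre G \<longleftrightarrow>
     (\<exists>\<sigma> :: nat \<Rightarrow> 'a set.
        (\<forall>n. \<sigma> n \<in> moves G) \<and>
        (\<forall>x. (\<forall>n. x n \<in> \<sigma> n) \<longrightarrow> x \<notin> target G))"

definition I_wins_cnst :: "'a game \<Rightarrow> bool" where
  "I_wins_cnst G \<longleftrightarrow>
     (\<exists>A\<in>moves G. \<forall>x. (\<forall>n. x n \<in> A) \<longrightarrow> x \<notin> target G)"

definition II_wins :: "'a game \<Rightarrow> bool" where
  "II_wins G \<longleftrightarrow>
     (\<exists>\<tau> :: 'a set list \<Rightarrow> 'a.
        (\<forall>As\<in>lists (moves G). As \<noteq> [] \<longrightarrow> \<tau> As \<in> last As) \<and>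
        (\<forall>A. (\<forall>n. A n \<in> moves G) \<longrightarrow> (\<lambda>n. \<tau> (map A [0..<Suc n])) \<in> target G))"

definition II_wins_mark :: "'a game \<Rightarrow> bool" where
  "II_wins_mark G \<longleftrightarrow>
     (\<exists>\<tau> :: 'a set \<Rightarrow> nat \<Rightarrow> 'a.
        (\<forall>A\<in>moves G. \<forall>n. \<tau> A n \<in> A) \<and>
        (\<forall>A. (\<forall>n. A n \<in> moves G) \<longrightarrow> (\<lambda>n. \<tau> (A n) n) \<in> target G))"

definition game_le :: "'a game \<Rightarrow> 'b game \<Rightarrow> bool"  (infix "\<le>\<^sub>I\<^sub>I\<^sup>+" 50) where
  "G \<le>\<^sub>I\<^sub>I\<^sup>+ H \<longleftrightarrow>
     (II_wins_mark G \<longrightarrow> II_wins_mark H) \<and>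
     (II_wins G \<longrightarrow> II_wins H) \<and>
     (\<not> I_wins G \<longrightarrow> \<not> I_wins H) \<and>
     (\<not> I_wins_pre G \<longrightarrow> \<not> I_wins_pre H) \<and>
     (\<not> I_wins_cnst G \<longrightarrow> \<not> I_wins_cnst H)"

end

(*
  Every nonempty open set W of the hyperspace contains all sets insert x K with x in V, for a
  suitable finite K and a nonempty open V of X. So P2 answers W by insert x K, where x is the answer
  to V in the game on X, and P1's strategies are transported in the opposite direction. It remains
  to see that if s is discrete along S in X and s n \<in> F n for all n, then F is discrete along S in
  the hyperspace: given a finite set G, pass successively to subsequences on which s avoids a
  neighbourhood of each point of G; after finitely many steps s avoids a neighbourhood U of G, so that
  F avoids a hyperspace neighbourhood of G consisting of subsets of U.
*)
theory Submission
  imports Defs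
begin

section \<open>Transfer of strategies\<close>

text \<open>\<open>g\<close> carries P1's moves from \<open>H\<close> to \<open>G\<close>, and
  \<open>f\<close> carries P2's answers back. P2 in \<open>H\<close> consults a strategy for
  \<open>G\<close> against the image moves; the implications about P1 are proved contrapositively,
  P1 in \<open>G\<close> simulating a play of \<open>H\<close>.\<close>

lemma game_le_transfer:
  fixes G :: "'a game" and H :: "'b game" and g :: "'b set \<Rightarrow> 'a set" and f :: "'b set \<Rightarrow> 'a \<Rightarrow> 'b"
  assumes g: "\<And>B. B \<in> moves H \<Longrightarrow> g B \<in> moves G"
    and f: "\<And>B x. B \<in> moves H \<Longrightarrow> x \<in> g B \<Longrightarrow> f B x \<in> B"
    and target: "\<And>B x. (\<And>n. B n \<in> moves H) \<Longrightarrow> (\<And>n. x n \<in> g (B n)) \<Longrightarrow> x \<in> target G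
      \<Longrightarrow> (\<lambda>n. f (B n) (x n)) \<in> target H"
  shows "G \<le>\<^sub>I\<^sub>I\<^sup>+ H"
proof -
  have mark: "II_wins_mark H" if G: "II_wins_mark G"
  proof -
    obtain \<tau> where \<tau>: "\<And>A n. A \<in> moves G \<Longrightarrow> \<tau> A n \<in> A"
      "\<And>A. (\<And>n. A n \<in> moves G) \<Longrightarrow> (\<lambda>n. \<tau> (A n) n) \<in> target G"
      using G unfolding II_wins_mark_def by blast
    have "(\<lambda>n. f (B n) (\<tau> (g (B n)) n)) \<in> target H" if "\<And>n. B n \<in> moves H" for B
      using that by (intro target \<tau> g)
    then show ?thesis
      unfolding II_wins_mark_def
      by (intro exI[of _ "\<lambda>B n. f B (\<tau> (g B) n)"]) (simp add: f g \<tau>(1))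
  qed
  have full: "II_wins H" if G: "II_wins G"
  proof -
    obtain \<tau> where legal: "\<And>As. As \<in> lists (moves G) \<Longrightarrow> As \<noteq> [] \<Longrightarrow> \<tau> As \<in> last As"
      and win: "\<And>A. (\<And>n. A n \<in> moves G) \<Longrightarrow> (\<lambda>n. \<tau> (map A [0..<Suc n])) \<in> target G"
      using G unfolding II_wins_def by blast
    have answer: "\<tau> (map g Bs) \<in> g (last Bs)" if "Bs \<in> lists (moves H)" "Bs \<noteq> []" for Bs
    proof -
      have "map g Bs \<in> lists (moves G)"
        using that(1) g by (auto simp: in_lists_conv_set)
      then show ?thesis using legal[of "map g Bs"] that(2) by (simp add: last_map)
    qed
    show ?thesis
      unfolding II_wins_def
    proof (intro exI[of _ "\<lambda>Bs. f (last Bs) (\<tau> (map g Bs))"] conjI ballI impI allI)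
      fix Bs assume Bs: "Bs \<in> lists (moves H)" "Bs \<noteq> []"
      then have "last Bs \<in> moves H" by auto
      then show "f (last Bs) (\<tau> (map g Bs)) \<in> last Bs"
        using answer[OF Bs] by (rule f)
    next
      fix B :: "nat \<Rightarrow> 'b set" assume B: "\<forall>n. B n \<in> moves H"
      have "\<tau> (map (g \<circ> B) [0..<Suc n]) \<in> g (B n)" for n
        using answer[of "map B [0..<Suc n]"] B by (auto simp: in_lists_conv_set)
      moreover have "(\<lambda>n. \<tau> (map (g \<circ> B) [0..<Suc n])) \<in> target G"
        using B g by (intro win) simp
      ultimately have "(\<lambda>n. f (B n) (\<tau> (map (g \<circ> B) [0..<Suc n]))) \<in> target H"
        using B by (intro target) auto
      then show "(\<lambda>n. f (last (map B [0..<Suc n])) (\<tau> (map g (map B [0..<Suc n])))) \<in> target H"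
        by simp
    qed
  qed
  have I: "I_wins G" if H: "I_wins H"
  proof -
    obtain \<sigma> where legal: "\<And>ys. ys \<in> lists (\<Union>(moves H)) \<Longrightarrow> \<sigma> ys \<in> moves H"
      and win: "\<And>y. (\<And>n. y n \<in> \<sigma> (map y [0..<n])) \<Longrightarrow> y \<notin> target H"
      using H unfolding I_wins_def by blast
    \<comment> \<open>\<open>tr\<close> rebuilds the history of the simulated play of
      \<open>H\<close>: each point is translated by \<open>f\<close> relative to the move that
      \<open>\<sigma>\<close> makes after the part already rebuilt.\<close>
    define tr where "tr = foldl (\<lambda>ys x. ys @ [f (\<sigma> ys) x]) []"
    \<comment> \<open>The second branch only serves positions that are not reached when P1 follows \<open>\<rho>\<close>.\<close>
    define \<rho> where
      "\<rho> xs = (if tr xs \<in> lists (\<Union>(moves H)) then g (\<sigma> (tr xs)) else g (\<sigma> []))" for xs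
    have "\<rho> xs \<in> moves G" for xs
      unfolding \<rho>_def using g legal by simp
    moreover have "x \<notin> target G" if x: "\<And>n. x n \<in> \<rho> (map x [0..<n])" for x
    proof
      assume xG: "x \<in> target G"
      define B where "B n = \<sigma> (tr (map x [0..<n]))" for n
      define y where "y n = f (B n) (x n)" for n
      have tr: "tr (map x [0..<n]) = map y [0..<n]" for n
      proof (induction n)
        case (Suc n)
        then show ?case by (simp add: y_def B_def tr_def)
      qed (simp add: tr_def)
      \<comment> \<open>Legality is circular: \<open>B n\<close> is a move once the earlier values
        of \<open>y\<close> are legal, and \<open>y n\<close> is legal once \<open>B n\<close> is a
        move. Hence the conditional form, whose premise is discharged by the induction in
        \<open>ys\<close>.\<close>
      have step: "B n \<in> moves H \<and> x n \<in> g (B n) \<and> y n \<in> B n"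
        if "map y [0..<n] \<in> lists (\<Union>(moves H))" for n
      proof -
        have "B n \<in> moves H" "x n \<in> g (B n)"
          using that legal x[of n] by (simp_all add: B_def tr \<rho>_def)
        then show ?thesis using f by (simp add: y_def)
      qed
      have ys: "map y [0..<n] \<in> lists (\<Union>(moves H))" for n
      proof (induction n)
        case (Suc n)
        then show ?case using step[OF Suc] by auto
      qed simp
      have "y \<in> target H"
        unfolding y_def using step[OF ys] xG by (intro target) auto
      moreover have "y n \<in> \<sigma> (map y [0..<n])" for n
        using step[OF ys, of n] by (simp add: B_def tr)
      ultimately show False using win by blast
    qed
    ultimately show ?thesis
      unfolding I_wins_def by blast
  qed
  have pre: "I_wins_pre G" if H: "I_wins_pre H"
  proof -
    obtain \<sigma> where \<sigma>: "\<And>n. \<sigma> n \<in> moves H" "\<And>y. (\<And>n. y n \<in> \<sigma> n) \<Longrightarrow> y \<notin> target H"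
      using H unfolding I_wins_pre_def by blast
    have "x \<notin> target G" if x: "\<And>n. x n \<in> g (\<sigma> n)" for x
      using target[of \<sigma> x] \<sigma>(2)[of "\<lambda>n. f (\<sigma> n) (x n)"] f \<sigma>(1) x by blast
    then show ?thesis
      unfolding I_wins_pre_def using g \<sigma>(1) by (intro exI[of _ "\<lambda>n. g (\<sigma> n)"]) simp
  qed
  have cnst: "I_wins_cnst G" if H: "I_wins_cnst H"
  proof -
    obtain B where B: "B \<in> moves H" "\<And>y. (\<And>n. y n \<in> B) \<Longrightarrow> y \<notin> target H"
      using H unfolding I_wins_cnst_def by blast
    have "x \<notin> target G" if x: "\<And>n. x n \<in> g B" for x
      using target[of "\<lambda>_. B" x] B(2)[of "\<lambda>n. f B (x n)"] f B(1) x by blast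
    then show ?thesis
      unfolding I_wins_cnst_def using g[OF B(1)] by blast
  qed
  show ?thesis
    unfolding game_le_def using mark full I pre cnst by blast
qed

section \<open>Hyperspaces of finite sets\<close>

lemma topspace_hyperspace:
  assumes "H \<in> {vietoris X, pixley_roy X}"
  shows "topspace H = finite_subsets X"
  using assms topspace_vietoris topspace_pixley_roy by blast

text \<open>Take a basic set inside \<open>W\<close> and let \<open>K\<close> consist of one point
  from each of its finitely many open sets. With one of these open sets as \<open>V\<close>, adding
  a point of \<open>V\<close> to \<open>K\<close> stays inside the basic set.\<close>

lemma vietoris_open_insert:
  assumes "W \<in> nonempty_opens (vietoris X)"
  shows "\<exists>V\<in>nonempty_opens X. \<exists>K. \<forall>x\<in>V. insert x K \<in> W"
proof -
  obtain \<C> where \<C>: "\<C> \<subseteq> vietoris_basis X" "W = \<Union>\<C>" "W \<noteq> {}"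
    using assms by (auto simp: nonempty_opens_def openin_vietoris)
  then obtain B where B: "B \<in> \<C>" by blast
  then have "B \<in> vietoris_basis X" using \<C>(1) by blast
  then obtain \<U> where \<U>: "finite \<U>" "\<U> \<noteq> {}" "\<U> \<subseteq> nonempty_opens X" "B = vietoris_set X \<U>"
    unfolding vietoris_basis_def by auto
  have "\<forall>U\<in>\<U>. \<exists>p. p \<in> U"
    using \<U>(3) by (auto simp: nonempty_opens_def)
  then obtain p where p: "\<And>U. U \<in> \<U> \<Longrightarrow> p U \<in> U" by metis
  obtain V where V: "V \<in> \<U>" using \<U>(2) by blast
  have "insert x (p ` \<U>) \<in> vietoris_set X \<U>" if "x \<in> V" for x
  proof -
    have "insert x (p ` \<U>) \<subseteq> \<Union>\<U>" using that V p by blast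
    moreover have "\<Union>\<U> \<subseteq> topspace X"
      using \<U>(3) openin_subset unfolding nonempty_opens_def by (intro Union_least) blast
    ultimately show ?thesis
      using p \<U>(1) by (auto simp: vietoris_set_def finite_subsets_def)
  qed
  then have "\<forall>x\<in>V. insert x (p ` \<U>) \<in> W" using B \<U>(4) \<C>(2) by blast
  moreover have "V \<in> nonempty_opens X" using V \<U>(3) by blast
  ultimately show ?thesis by blast
qed

lemma pixley_roy_open_insert:
  assumes "W \<in> nonempty_opens (pixley_roy X)"
  shows "\<exists>V\<in>nonempty_opens X. \<exists>K. \<forall>x\<in>V. insert x K \<in> W"
proof -
  obtain \<C> G where "\<C> \<subseteq> pixley_roy_basis X" "W = \<Union>\<C>" "G \<in> W"
    using assms by (auto simp: nonempty_opens_def openin_pixley_roy)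
  then obtain F V where F: "F \<in> finite_subsets X" and V: "V \<in> nonempty_opens X"
    and W: "pixley_roy_set X F V \<subseteq> W" and G: "G \<in> pixley_roy_set X F V"
    unfolding pixley_roy_basis_def by blast
  have "V \<subseteq> topspace X"
    using V openin_subset by (auto simp: nonempty_opens_def)
  \<comment> \<open>The member \<open>G\<close> of the basic set witnesses
    \<open>F \<subseteq> V\<close>, so \<open>F\<close> can serve as \<open>K\<close>.\<close>
  then have "\<forall>x\<in>V. insert x F \<in> pixley_roy_set X F V"
    using F G by (auto simp: pixley_roy_set_def finite_subsets_def)
  then show ?thesis using V W by blast
qed

lemma hyperspace_open_insert:
  assumes "H \<in> {vietoris X, pixley_roy X}" "W \<in> nonempty_opens H"
  shows "\<exists>V\<in>nonempty_opens X. \<exists>K. \<forall>x\<in>V. insert x K \<in> W"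
  using assms vietoris_open_insert pixley_roy_open_insert by blast

lemma vietoris_basis_open: "W \<in> vietoris_basis X \<Longrightarrow> openin (vietoris X) W"
  unfolding openin_vietoris by (intro exI[of _ "{W}"]) simp

lemma pixley_roy_basis_open: "W \<in> pixley_roy_basis X \<Longrightarrow> openin (pixley_roy X) W"
  unfolding openin_pixley_roy by (intro exI[of _ "{W}"]) simp

text \<open>The neighbourhood is \<open>[U]\<close> for the Vietoris and \<open>[G, U]\<close> for
  the Pixley-Roy topology. It lets a single point outside \<open>U\<close> keep a finite set out of
  \<open>W\<close>.\<close>

lemma hyperspace_nhd:
  assumes H: "H \<in> {vietoris X, pixley_roy X}"
    and G: "G \<in> finite_subsets X" "G \<subseteq> U" and U: "openin X U"
  shows "\<exists>W. openin H W \<and> G \<in> W \<and> (\<forall>F\<in>W. F \<subseteq> U)"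
proof -
  have "U \<in> nonempty_opens X"
    using G U by (auto simp: nonempty_opens_def finite_subsets_def)
  then have "vietoris_set X {U} \<in> vietoris_basis X"
    unfolding vietoris_basis_def by (auto intro!: exI[of _ "{U}"])
  moreover have "pixley_roy_set X G U \<in> pixley_roy_basis X"
    using \<open>U \<in> nonempty_opens X\<close> G(1) unfolding pixley_roy_basis_def by auto
  ultimately have "openin (vietoris X) (vietoris_set X {U})"
    "openin (pixley_roy X) (pixley_roy_set X G U)"
    using vietoris_basis_open pixley_roy_basis_open by blast+
  moreover have "G \<in> vietoris_set X {U}" "G \<in> pixley_roy_set X G U"
    using G by (auto simp: vietoris_set_def pixley_roy_set_def finite_subsets_def)
  moreover have "\<forall>F\<in>vietoris_set X {U}. F \<subseteq> U" "\<forall>F\<in>pixley_roy_set X G U. F \<subseteq> U"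
    by (auto simp: vietoris_set_def pixley_roy_set_def)
  ultimately show ?thesis using H by blast
qed

section \<open>Discrete sequences of points and of finite sets\<close>

lemma SDS_semi_avoids_finite:
  assumes S: "subsemigroup S" and s: "s \<in> SDS_semi S X"
    and "finite G" "G \<noteq> {}" "G \<subseteq> topspace X" "\<phi> \<in> S"
  shows "\<exists>U. openin X U \<and> G \<subseteq> U \<and> (\<exists>\<psi>\<in>S. \<forall>n. s (\<phi> (\<psi> n)) \<notin> U)"
  using \<open>finite G\<close> \<open>G \<noteq> {}\<close> \<open>G \<subseteq> topspace X\<close>
proof (induction G rule: finite_ne_induct)
  case (singleton x)
  then show ?case using s \<open>\<phi> \<in> S\<close> by (simp add: SDS_semi_def)
next
  case (insert x G)
  then obtain U \<psi> where U: "openin X U" "G \<subseteq> U" "\<psi> \<in> S" "\<And>n. s (\<phi> (\<psi> n)) \<notin> U"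
    by auto
  \<comment> \<open>Closure under composition lets discreteness at \<open>x\<close> be applied along
    the subsequence that already avoids \<open>U\<close>; thinning it further by
    \<open>\<eta>\<close> keeps avoiding \<open>U\<close>.\<close>
  have "\<phi> \<circ> \<psi> \<in> S"
    using S \<open>\<phi> \<in> S\<close> U(3) by (simp add: subsemigroup_def)
  then obtain V \<eta> where V: "openin X V" "x \<in> V" "\<eta> \<in> S" "\<And>n. s (\<phi> (\<psi> (\<eta> n))) \<notin> V"
    using s insert.prems unfolding SDS_semi_def by fastforce
  have "\<psi> \<circ> \<eta> \<in> S"
    using S U(3) V(3) by (simp add: subsemigroup_def)
  moreover have "\<forall>n. s (\<phi> ((\<psi> \<circ> \<eta>) n)) \<notin> U \<union> V"
    using U(4) V(4) by simp
  moreover have "openin X (U \<union> V)" "insert x G \<subseteq> U \<union> V"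
    using U V by auto
  ultimately show ?case by blast
qed

lemma SDS_semi_hyperspace:
  assumes H: "H \<in> {vietoris X, pixley_roy X}" and S: "subsemigroup S"
    and s: "s \<in> SDS_semi S X" and F: "F \<in> seqs H" "\<And>n. s n \<in> F n"
  shows "F \<in> SDS_semi S H"
proof -
  have "\<exists>W. openin H W \<and> G \<in> W \<and> (\<exists>\<psi>\<in>S. \<forall>n. F (\<phi> (\<psi> n)) \<notin> W)"
    if \<phi>: "\<phi> \<in> S" and "G \<in> topspace H" for \<phi> G
  proof -
    have G: "G \<in> finite_subsets X"
      using that topspace_hyperspace[OF H] by simp
    then obtain U \<psi> where U: "openin X U" "G \<subseteq> U" "\<psi> \<in> S" "\<And>n. s (\<phi> (\<psi> n)) \<notin> U"
      using SDS_semi_avoids_finite[OF S s, of G \<phi>] \<phi> by (auto simp: finite_subsets_def)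
    obtain W where W: "openin H W" "G \<in> W" "\<And>F. F \<in> W \<Longrightarrow> F \<subseteq> U"
      using hyperspace_nhd[OF H G U(2,1)] by blast
    \<comment> \<open>Membership in \<open>W\<close> would place the set inside \<open>U\<close>,
      although it contains the point \<open>s (\<phi> (\<psi> n))\<close>.\<close>
    have "F (\<phi> (\<psi> n)) \<notin> W" for n
      using W(3) F(2) U(4) by blast
    then show ?thesis using U(3) W(1,2) by blast
  qed
  then show ?thesis using F(1) by (simp add: SDS_semi_def)
qed

section \<open>The classical classes as instances of \<open>TT\<close>\<close>

lemma subsemigroup_incr: "subsemigroup incr"
  by (auto simp: subsemigroup_def incr_def strict_mono_o)

lemma seqs_comp: "s \<in> seqs X \<Longrightarrow> s \<circ> \<phi> \<in> seqs X"
  by (auto simp: seqs_def)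

lemma SDS_eq_SDS_semi: "SDS X = SDS_semi incr X"
proof (intro equalityI subsetI)
  fix s assume s: "s \<in> SDS X"
  then have seq: "s \<in> seqs X" by (simp add: SDS_def)
  have "\<exists>U. openin X U \<and> x \<in> U \<and> (\<exists>\<psi>\<in>incr. \<forall>n. s (\<phi> (\<psi> n)) \<notin> U)"
    if "\<phi> \<in> incr" and x: "x \<in> topspace X" for \<phi> x
  proof -
    have "\<not> limitin X (s \<circ> \<phi>) x sequentially"
      using s that seqs_comp[OF seq, of \<phi>] by (auto simp: SDS_def CS_def)
    then obtain U where U: "openin X U" "x \<in> U" "\<not> (\<forall>\<^sub>F n in sequentially. s (\<phi> n) \<in> U)"
      using x by (auto simp: limitin_def)
    \<comment> \<open>Not being eventually in \<open>U\<close> means being outside \<open>U\<close>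
      for infinitely many indices; their increasing enumeration serves as
      \<open>\<psi>\<close>.\<close>
    then have inf: "infinite {n. s (\<phi> n) \<notin> U}"
      by (simp add: not_eventually cofinite_eq_sequentially[symmetric] eventually_cofinite)
    then have "enumerate {n. s (\<phi> n) \<notin> U} \<in> incr"
      by (simp add: incr_def strict_mono_enumerate)
    moreover have "\<forall>n. s (\<phi> (enumerate {n. s (\<phi> n) \<notin> U} n)) \<notin> U"
      using enumerate_in_set[OF inf] by simp
    ultimately show ?thesis using U(1,2) by blast
  qed
  then show "s \<in> SDS_semi incr X" using seq by (simp add: SDS_semi_def)
next
  fix s assume s: "s \<in> SDS_semi incr X"
  have "s \<circ> \<phi> \<notin> CS X" if \<phi>: "\<phi> \<in> incr" for \<phi>
  proof
    assume "s \<circ> \<phi> \<in> CS X"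
    then obtain x where x: "x \<in> topspace X" "limitin X (s \<circ> \<phi>) x sequentially"
      by (auto simp: CS_def)
    then obtain U \<psi> where U: "openin X U" "x \<in> U" "\<psi> \<in> incr" "\<And>n. s (\<phi> (\<psi> n)) \<notin> U"
      using s \<phi> unfolding SDS_semi_def by blast
    obtain N where "\<And>n. n \<ge> N \<Longrightarrow> s (\<phi> n) \<in> U"
      using x(2) U(1,2) by (auto simp: limitin_def eventually_sequentially)
    \<comment> \<open>The index \<open>\<psi> N\<close> is past the threshold \<open>N\<close>,
      which puts \<open>s (\<phi> (\<psi> N))\<close> into \<open>U\<close>.\<close>
    moreover have "N \<le> \<psi> N"
      using U(3) by (auto simp: incr_def intro: strict_mono_imp_increasing)
    ultimately show False using U(4) by blast
  qed
  then show "s \<in> SDS X" using s by (simp add: SDS_def SDS_semi_def)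
qed

lemma SDS_eq_TT: "SDS X = TT {id} incr X"
proof -
  have "SDS_semi incr X \<subseteq> seqs X" by (simp add: SDS_semi_def)
  then show ?thesis by (auto simp: TT_def SDS_eq_SDS_semi)
qed

lemma wSD_eq_TT: "wSD X = TT incr incr X"
  by (simp add: wSD_def TT_def SDS_eq_SDS_semi)

lemma wSD_alpha_eq_TT: "wSD_alpha \<alpha> X = TT (Dstar \<alpha>) incr X"
  by (simp add: wSD_alpha_def TT_def SDS_eq_SDS_semi)

text \<open>The \<open>\<phi>\<close> that works for \<open>s\<close> also works for
  \<open>F\<close>, since \<open>s (\<phi> n) \<in> F (\<phi> n)\<close>.\<close>

lemma TT_hyperspace:
  assumes H: "H \<in> {vietoris X, pixley_roy X}" and S: "subsemigroup S"
    and s: "s \<in> TT E S X" and F: "F \<in> seqs H" "\<And>n. s n \<in> F n"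
  shows "F \<in> TT E S H"
proof -
  obtain \<phi> where \<phi>: "\<phi> \<in> E" "s \<circ> \<phi> \<in> SDS_semi S X"
    using s by (auto simp: TT_def)
  have "F \<circ> \<phi> \<in> SDS_semi S H"
    using SDS_semi_hyperspace[OF H S \<phi>(2) seqs_comp[OF F(1)]] F(2) by simp
  then show ?thesis using F(1) \<phi>(1) by (auto simp: TT_def)
qed

section \<open>Comeager sets and the class \<open>gSDS\<close>\<close>

lemma meager_in_subset:
  assumes "meager_in X A" "B \<subseteq> A"
  shows "meager_in X B"
proof -
  obtain \<N> where \<N>: "countable \<N>" "\<And>N. N \<in> \<N> \<Longrightarrow> nowhere_dense_in X N" "A = \<Union>\<N>"
    using assms(1) unfolding meager_in_def by blast
  \<comment> \<open>\<open>meager_in\<close> asks for an exact union, so each piece of the cover of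
    \<open>A\<close> is cut down to \<open>B\<close>.\<close>
  have "nowhere_dense_in X (N \<inter> B)" if "N \<in> \<N>" for N
  proof -
    have "X interior_of (X closure_of (N \<inter> B)) \<subseteq> X interior_of (X closure_of N)"
      by (intro interior_of_mono closure_of_mono) simp
    then show ?thesis
      using \<N>(2)[OF that] by (auto simp: nowhere_dense_in_def)
  qed
  moreover have "countable ((\<lambda>N. N \<inter> B) ` \<N>)" "B = (\<Union>N\<in>\<N>. N \<inter> B)"
    using \<N>(1,3) assms(2) by auto
  ultimately show ?thesis
    unfolding meager_in_def by (intro exI[of _ "(\<lambda>N. N \<inter> B) ` \<N>"]) simp
qed

lemma comeager_in_superset:
  assumes "comeager_in X A" "A \<subseteq> B" "B \<subseteq> topspace X"
  shows "comeager_in X B"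
  using assms meager_in_subset[of X "topspace X - A" "topspace X - B"]
  by (auto simp: comeager_in_def)

text \<open>Every \<open>\<phi>\<close> that makes \<open>s\<close> discrete makes \<open>F\<close>
  discrete, so the set of good \<open>\<phi>\<close> can only grow, and comeagerness
  survives.\<close>

lemma gSDS_hyperspace:
  assumes H: "H \<in> {vietoris X, pixley_roy X}"
    and s: "s \<in> gSDS X" and F: "F \<in> seqs H" "\<And>n. s n \<in> F n"
  shows "F \<in> gSDS H"
proof -
  have "F \<circ> \<phi> \<in> SDS H" if "s \<circ> \<phi> \<in> SDS X" for \<phi>
    using SDS_semi_hyperspace[OF H subsemigroup_incr _ seqs_comp[OF F(1)], of "s \<circ> \<phi>" \<phi>] that F(2)
    by (simp add: SDS_eq_SDS_semi)
  then have "{\<phi> \<in> incr. s \<circ> \<phi> \<in> SDS X} \<subseteq> {\<phi> \<in> incr. F \<circ> \<phi> \<in> SDS H}" by blast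
  moreover have "{\<phi> \<in> incr. F \<circ> \<phi> \<in> SDS H} \<subseteq> topspace incr_topology"
    by (auto simp: incr_topology_def)
  ultimately show ?thesis
    using s F(1) comeager_in_superset by (fastforce simp: gSDS_def)
qed

section \<open>Comparison of the games on the space and on its hyperspaces\<close>

lemma game_le_hyperspace:
  assumes H: "H \<in> {vietoris X, pixley_roy X}"
    and target: "\<And>s F. s \<in> \<B> \<Longrightarrow> F \<in> seqs H \<Longrightarrow> (\<And>n. s n \<in> F n) \<Longrightarrow> F \<in> \<B>'"
  shows "G1 (nonempty_opens X) \<B> \<le>\<^sub>I\<^sub>I\<^sup>+ G1 (nonempty_opens H) \<B>'"
proof -
  \<comment> \<open>\<open>V W\<close> replaces the move \<open>W\<close> in the game on
    \<open>X\<close>, and \<open>K W\<close> completes P2's answer there to an element of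
    \<open>W\<close>.\<close>
  obtain V K where VK: "\<And>W. W \<in> nonempty_opens H \<Longrightarrow> V W \<in> nonempty_opens X"
    "\<And>W x. W \<in> nonempty_opens H \<Longrightarrow> x \<in> V W \<Longrightarrow> insert x (K W) \<in> W"
    using hyperspace_open_insert[OF H] by metis
  show ?thesis
  proof (rule game_le_transfer[where g = V and f = "\<lambda>W x. insert x (K W)"])
    fix W x
    assume W: "\<And>n. W n \<in> moves (G1 (nonempty_opens H) \<B>')" and x: "\<And>n. x n \<in> V (W n)"
      and "x \<in> target (G1 (nonempty_opens X) \<B>)"
    moreover have "insert (x n) (K (W n)) \<in> topspace H" for n
    proof -
      have "W n \<in> nonempty_opens H" using W by simp
      then show ?thesis
        using VK(2)[OF _ x] openin_subset unfolding nonempty_opens_def by blast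
    qed
    ultimately show "(\<lambda>n. insert (x n) (K (W n))) \<in> target (G1 (nonempty_opens H) \<B>')"
      using target[of x "\<lambda>n. insert (x n) (K (W n))"] by (auto simp: seqs_def)
  qed (use VK in auto)
qed

theorem theorem3p31:
  fixes X :: "'a topology" and H :: "'a set topology"
  assumes "topspace X \<noteq> {}"
    and "H \<in> {vietoris X, pixley_roy X}"
  shows "(\<forall>S E. subsemigroup S \<longrightarrow> E \<subseteq> incr \<longrightarrow>
            G1 (nonempty_opens X) (TT E S X) \<le>\<^sub>I\<^sub>I\<^sup>+ G1 (nonempty_opens H) (TT E S H)) \<and>
         G1 (nonempty_opens X) (SDS X) \<le>\<^sub>I\<^sub>I\<^sup>+ G1 (nonempty_opens H) (SDS H) \<and>
         G1 (nonempty_opens X) (wSD X) \<le>\<^sub>I\<^sub>I\<^sup>+ G1 (nonempty_opens H) (wSD H) \<and>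
         G1 (nonempty_opens X) (gSDS X) \<le>\<^sub>I\<^sub>I\<^sup>+ G1 (nonempty_opens H) (gSDS H) \<and>
         (\<forall>\<alpha>\<in>{0<..1}.
            G1 (nonempty_opens X) (wSD_alpha \<alpha> X) \<le>\<^sub>I\<^sub>I\<^sup>+ G1 (nonempty_opens H) (wSD_alpha \<alpha> H))"
proof -
  note H = assms(2)
  have TT: "G1 (nonempty_opens X) (TT E S X) \<le>\<^sub>I\<^sub>I\<^sup>+ G1 (nonempty_opens H) (TT E S H)"
    if "subsemigroup S" for S E
    using game_le_hyperspace[OF H TT_hyperspace[OF H that]] .
  moreover have "G1 (nonempty_opens X) (gSDS X) \<le>\<^sub>I\<^sub>I\<^sup>+ G1 (nonempty_opens H) (gSDS H)"
    using game_le_hyperspace[OF H gSDS_hyperspace[OF H]] .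
  ultimately show ?thesis
    \<comment> \<open>With \<open>S = incr\<close>, the choices \<open>{id}\<close>,
      \<open>incr\<close> and \<open>Dstar \<alpha>\<close> for \<open>E\<close> give the three
      remaining kinds of class.\<close>
    using TT[OF subsemigroup_incr] by (simp add: SDS_eq_TT wSD_eq_TT wSD_alpha_eq_TT)
qed

end
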